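(* Let $\mathcal{C}$ be a symmetric collection of sub-intervals $[p,q]$ (with $1\le p<q\le n$) of the integer interval $[1,n]$. Let $G_{\mathcal{C}}$ be the group with generators $s_I$, $I\in\mathcal{C}$, and as relations all relations of types (j1)–(j3) of $J_n$ that involve only generators $s_I$ with $I \in \mathcal{C}$. Then the natural homomorphism $G_{\mathcal{C}} \to J_n$, $s_I\mapsto s_I$, is injective; i.e. the set of generators $\{s_I \mid I\in\mathcal{C}\}$ is complete.
   Context: For $n \ge 2$, the cactus group $J_n$ is the group with generators $s_{p,q}$ ($=s_{[p,q]}$) for $1 \le p < q \le n$ and relations: (j1) $s_{p,q}^2 = 1$; (j2) $s_{p,q}s_{m,r} = s_{m,r}s_{p,q}$ whenever $[p,q]\cap[m,r]=\emptyset$; (j3) $s_{p,q}s_{m,r} = s_{p+q-r,\,p+q-m}\,s_{p,q}$ whenever $[m,r]\subset[p,q]$. Given a group presentation $\langle S\mid R\rangle$ and a subset $I\subseteq S$, one forms $\langle I \mid R_I\rangle$ where $R_I$ consists of the relations of $R$ involving only generators in $I$; $I$ is called complete if the natural map $\langle I\mid R_I\rangle \to \langle S\mid R\rangle$ is injective. A collection $\mathcal{C}$ of sub-intervals of $[1,n]$ is called symmetric if whenever $[m,r]\subset[p,q]$ are both in $\mathcal{C}$, the interval $[p+q-r,\,p+q-m]$ is also in $\mathcal{C}$. *)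

theory Defs
  imports "HOL-Algebra.Group"
begin

text \<open>
  Group presentations. A word over the generators \<open>S\<close> is a list of letters \<open>(x, b)\<close>, where
  \<open>(x, True)\<close> stands for the generator \<open>x\<close> and \<open>(x, False)\<close> for its formal inverse. A relation
  \<open>u = v\<close> is a pair of words \<open>(u, v)\<close>.
\<close>

type_synonym 'a word = "('a \<times> bool) list"

definition words :: "'a set \<Rightarrow> 'a word set" where
  "words S = lists (S \<times> UNIV)"

inductive_set pres_cong :: "'a set \<Rightarrow> ('a word \<times> 'a word) set \<Rightarrow> ('a word \<times> 'a word) set"
  for S :: "'a set" and R :: "('a word \<times> 'a word) set" where
  refl: "w \<in> words S \<Longrightarrow> (w, w) \<in> pres_cong S R"
| sym: "(v, w) \<in> pres_cong S R \<Longrightarrow> (w, v) \<in> pres_cong S R"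
| trans: "(u, v) \<in> pres_cong S R \<Longrightarrow> (v, w) \<in> pres_cong S R \<Longrightarrow> (u, w) \<in> pres_cong S R"
| cancel: "u \<in> words S \<Longrightarrow> v \<in> words S \<Longrightarrow> x \<in> S \<Longrightarrow>
    (u @ [(x, b), (x, \<not> b)] @ v, u @ v) \<in> pres_cong S R"
| rel: "u \<in> words S \<Longrightarrow> v \<in> words S \<Longrightarrow> (l, r) \<in> R \<Longrightarrow> l \<in> words S \<Longrightarrow> r \<in> words S \<Longrightarrow>
    (u @ l @ v, u @ r @ v) \<in> pres_cong S R"

definition presented_group :: "'a set \<Rightarrow> ('a word \<times> 'a word) set \<Rightarrow> 'a word set monoid" where
  "presented_group S R =
    \<lparr>carrier = words S // pres_cong S R,
     mult = (\<lambda>A B. \<Union>a\<in>A. \<Union>b\<in>B. pres_cong S R `` {a @ b}),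
     one = pres_cong S R `` {[]}\<rparr>"

definition pres_gen :: "'a set \<Rightarrow> ('a word \<times> 'a word) set \<Rightarrow> 'a \<Rightarrow> 'a word set" where
  "pres_gen S R x = pres_cong S R `` {[(x, True)]}"

definition rels_restrict :: "('a word \<times> 'a word) set \<Rightarrow> 'a set \<Rightarrow> ('a word \<times> 'a word) set" where
  "rels_restrict R I = {(u, v) \<in> R. u \<in> words I \<and> v \<in> words I}"

text \<open>
  The natural map from \<open>presented_group I (rels_restrict R I)\<close> to \<open>presented_group S R\<close>, for
  \<open>I \<subseteq> S\<close>: the class of a word over \<open>I\<close> goes to the class of the same word over \<open>S\<close>.
\<close>

definition pres_natural :: "'a set \<Rightarrow> ('a word \<times> 'a word) set \<Rightarrow> 'a word set \<Rightarrow> 'a word set" where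
  "pres_natural S R A = (\<Union>w\<in>A. pres_cong S R `` {w})"

definition complete_gens :: "'a set \<Rightarrow> ('a word \<times> 'a word) set \<Rightarrow> 'a set \<Rightarrow> bool" where
  "complete_gens S R I \<longleftrightarrow>
    I \<subseteq> S \<and> inj_on (pres_natural S R) (carrier (presented_group I (rels_restrict R I)))"

text \<open>The integer interval \<open>[p, q]\<close> with \<open>p < q\<close> is encoded as the pair \<open>(p, q)\<close>. Below, \<open>p + q - r\<close>
  is never truncated, since \<open>r \<le> q\<close>; inclusion of intervals may be non-strict because the case of
  equality only adds trivial relations and conditions.\<close>

definition cactus_gens :: "nat \<Rightarrow> (nat \<times> nat) set" where
  "cactus_gens n = {(p, q). 1 \<le> p \<and> p < q \<and> q \<le> n}"

definition cactus_rels :: "nat \<Rightarrow> ((nat \<times> nat) word \<times> (nat \<times> nat) word) set" where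
  "cactus_rels n =
    {([((p, q), True), ((p, q), True)], []) | p q. (p, q) \<in> cactus_gens n} \<union>
    {([((p, q), True), ((m, r), True)], [((m, r), True), ((p, q), True)]) | p q m r.
      (p, q) \<in> cactus_gens n \<and> (m, r) \<in> cactus_gens n \<and> {p..q} \<inter> {m..r} = {}} \<union>
    {([((p, q), True), ((m, r), True)], [((p + q - r, p + q - m), True), ((p, q), True)]) | p q m r.
      (p, q) \<in> cactus_gens n \<and> (m, r) \<in> cactus_gens n \<and> {m..r} \<subseteq> {p..q}}"

definition cactus_group :: "nat \<Rightarrow> (nat \<times> nat) word set monoid" where
  "cactus_group n = presented_group (cactus_gens n) (cactus_rels n)"

definition symmetric_collection :: "(nat \<times> nat) set \<Rightarrow> bool" where
  "symmetric_collection C \<longleftrightarrow>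
    (\<forall>p q m r. (p, q) \<in> C \<longrightarrow> (m, r) \<in> C \<longrightarrow> {m..r} \<subseteq> {p..q} \<longrightarrow> (p + q - r, p + q - m) \<in> C)"

definition cactus_restricted_group :: "nat \<Rightarrow> (nat \<times> nat) set \<Rightarrow> (nat \<times> nat) word set monoid" where
  "cactus_restricted_group n C = presented_group C (rels_restrict (cactus_rels n) C)"

lemma words_append [simp]: "u @ v \<in> words S \<longleftrightarrow> u \<in> words S \<and> v \<in> words S"
  by (auto simp: words_def)

lemma words_Nil [simp]: "[] \<in> words S"
  by (simp add: words_def)

lemma words_Cons [simp]: "(x, b) # w \<in> words S \<longleftrightarrow> x \<in> S \<and> w \<in> words S"
  by (auto simp: words_def)

lemma pres_cong_words:
  assumes "(v, w) \<in> pres_cong S R"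
  shows "v \<in> words S \<and> w \<in> words S"
  using assms by induction auto

lemma equiv_pres_cong: "equiv (words S) (pres_cong S R)"
proof (rule equivI)
  show "pres_cong S R \<subseteq> words S \<times> words S"
    using pres_cong_words by fast
  show "refl_on (words S) (pres_cong S R)"
    by (rule refl_onI) (rule pres_cong.refl)
  show "sym (pres_cong S R)"
    by (rule symI) (rule pres_cong.sym)
  show "trans (pres_cong S R)"
    by (rule transI) (rule pres_cong.trans)
qed

lemma pres_cong_context:
  assumes "(v, w) \<in> pres_cong S R" "a \<in> words S" "b \<in> words S"
  shows "(a @ v @ b, a @ w @ b) \<in> pres_cong S R"
  using assms
proof induction
  case (cancel u v x c)
  then show ?case using pres_cong.cancel[of "a @ u" S "v @ b" x c R] by simp
next
  case (rel u v l r)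
  then show ?case using pres_cong.rel[of "a @ u" S "v @ b" l r R] by simp
next
  case (refl w)
  then show ?case by (simp add: pres_cong.refl)
next
  case (sym v w)
  then show ?case by (simp add: pres_cong.sym)
next
  case (trans u v w)
  then show ?case by (meson pres_cong.trans)
qed

lemma pres_cong_append:
  assumes "(a, a') \<in> pres_cong S R" "(b, b') \<in> pres_cong S R"
  shows "(a @ b, a' @ b') \<in> pres_cong S R"
proof -
  have "(a @ b, a' @ b) \<in> pres_cong S R"
    using pres_cong_context[OF assms(1), of "[]" b] pres_cong_words[OF assms(2)] by simp
  moreover have "(a' @ b, a' @ b') \<in> pres_cong S R"
    using pres_cong_context[OF assms(2), of a' "[]"] pres_cong_words[OF assms(1)] by simp
  ultimately show ?thesis by (rule pres_cong.trans)
qed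

lemma pres_cong_class_eq:
  assumes "(v, w) \<in> pres_cong S R"
  shows "pres_cong S R `` {v} = pres_cong S R `` {w}"
  using equiv_class_eq[OF equiv_pres_cong assms] .

lemma presented_group_mult:
  assumes "a \<in> words S" "b \<in> words S"
  shows "pres_cong S R `` {a} \<otimes>\<^bsub>presented_group S R\<^esub> pres_cong S R `` {b}
    = pres_cong S R `` {a @ b}"
proof -
  have "congruent2 (pres_cong S R) (pres_cong S R) (\<lambda>a b. pres_cong S R `` {a @ b})"
    by (rule congruent2I') (rule pres_cong_class_eq, rule pres_cong_append)
  from UN_equiv_class2[OF equiv_pres_cong equiv_pres_cong this assms]
  show ?thesis by (simp add: presented_group_def)
qed

lemma presented_group_carrierE:
  assumes "A \<in> carrier (presented_group S R)"
  obtains w where "w \<in> words S" "A = pres_cong S R `` {w}"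
  using assms by (auto simp: presented_group_def elim: quotientE)

lemma presented_group_carrierI:
  "w \<in> words S \<Longrightarrow> pres_cong S R `` {w} \<in> carrier (presented_group S R)"
  by (simp add: presented_group_def quotientI)

lemma pres_cong_inverse:
  assumes "w \<in> words S"
  shows "(rev (map (\<lambda>(x, b). (x, \<not> b)) w) @ w, []) \<in> pres_cong S R
    \<and> rev (map (\<lambda>(x, b). (x, \<not> b)) w) \<in> words S"
  using assms
proof (induction w)
  case Nil
  then show ?case by (simp add: pres_cong.refl)
next
  case (Cons y w)
  obtain x b where y: "y = (x, b)" by (cases y)
  let ?i = "rev (map (\<lambda>(x, b). (x, \<not> b)) w)"
  have IH: "(?i @ w, []) \<in> pres_cong S R" "?i \<in> words S"
    and x: "x \<in> S" "w \<in> words S" using Cons y by auto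
  have "(?i @ [(x, \<not> b), (x, \<not> \<not> b)] @ w, ?i @ w) \<in> pres_cong S R"
    by (rule pres_cong.cancel) (use IH x in auto)
  then have "(?i @ [(x, \<not> b), (x, \<not> \<not> b)] @ w, []) \<in> pres_cong S R"
    using IH(1) by (rule pres_cong.trans)
  then show ?case using IH x y by simp
qed

lemma group_presented_group: "group (presented_group S R)"
proof (rule groupI)
  have one: "\<one>\<^bsub>presented_group S R\<^esub> = pres_cong S R `` {[]}"
    by (simp add: presented_group_def)
  show "\<one>\<^bsub>presented_group S R\<^esub> \<in> carrier (presented_group S R)"
    by (simp add: one presented_group_carrierI)
  fix A assume A: "A \<in> carrier (presented_group S R)"
  then obtain a where a: "a \<in> words S" "A = pres_cong S R `` {a}"
    by (rule presented_group_carrierE)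
  show "\<one>\<^bsub>presented_group S R\<^esub> \<otimes>\<^bsub>presented_group S R\<^esub> A = A"
    using a by (simp add: one presented_group_mult)
  show "\<exists>B\<in>carrier (presented_group S R).
      B \<otimes>\<^bsub>presented_group S R\<^esub> A = \<one>\<^bsub>presented_group S R\<^esub>"
  proof (rule bexI)
    let ?i = "rev (map (\<lambda>(x, b). (x, \<not> b)) a)"
    have i: "(?i @ a, []) \<in> pres_cong S R" "?i \<in> words S"
      using pres_cong_inverse[OF a(1), of R] by auto
    show "pres_cong S R `` {?i} \<otimes>\<^bsub>presented_group S R\<^esub> A = \<one>\<^bsub>presented_group S R\<^esub>"
      unfolding a(2) one presented_group_mult[OF i(2) a(1)] by (rule pres_cong_class_eq[OF i(1)])
    show "pres_cong S R `` {?i} \<in> carrier (presented_group S R)"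
      by (rule presented_group_carrierI[OF i(2)])
  qed
  fix B assume "B \<in> carrier (presented_group S R)"
  then obtain b where b: "b \<in> words S" "B = pres_cong S R `` {b}"
    by (rule presented_group_carrierE)
  show "A \<otimes>\<^bsub>presented_group S R\<^esub> B \<in> carrier (presented_group S R)"
    using a b by (simp add: presented_group_mult presented_group_carrierI)
  fix D assume "D \<in> carrier (presented_group S R)"
  then obtain d where d: "d \<in> words S" "D = pres_cong S R `` {d}"
    by (rule presented_group_carrierE)
  show "A \<otimes>\<^bsub>presented_group S R\<^esub> B \<otimes>\<^bsub>presented_group S R\<^esub> D
      = A \<otimes>\<^bsub>presented_group S R\<^esub> (B \<otimes>\<^bsub>presented_group S R\<^esub> D)"
    using a b d by (simp add: presented_group_mult)
qed

lemma pres_cong_restrict_mono: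
  assumes "(v, w) \<in> pres_cong I (rels_restrict R I)" "I \<subseteq> S"
  shows "(v, w) \<in> pres_cong S R"
proof -
  have mono: "u \<in> words I \<Longrightarrow> u \<in> words S" for u
    using assms(2) unfolding words_def by auto
  show ?thesis
    using assms(1)
  proof induction
    case (cancel u v x b)
    then show ?case using mono assms(2) by (blast intro: pres_cong.cancel)
  next
    case (rel u v l r)
    then show ?case using mono by (auto simp: rels_restrict_def intro: pres_cong.rel)
  next
    case (refl w)
    then show ?case by (simp add: mono pres_cong.refl)
  next
    case (sym v w)
    then show ?case by (simp add: pres_cong.sym)
  next
    case (trans u v w)
    then show ?case by (meson pres_cong.trans)
  qed
qed

lemma pres_natural_class:
  assumes "w \<in> words I" "I \<subseteq> S"
  shows "pres_natural S R (pres_cong I (rels_restrict R I) `` {w}) = pres_cong S R `` {w}"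
proof -
  have "congruent (pres_cong I (rels_restrict R I)) (\<lambda>w. pres_cong S R `` {w})"
    by (rule congruentI) (rule pres_cong_class_eq, rule pres_cong_restrict_mono[OF _ assms(2)])
  from UN_equiv_class[OF equiv_pres_cong this assms(1)]
  show ?thesis by (simp add: pres_natural_def)
qed

end

theory Submission
  imports Defs "HOL-Library.Confluence"
begin

text \<open>
  Let a word \<open>s\<^sub>1 s\<^sub>2 \<dots> s\<^sub>k\<close> in the generators of the cactus group act on the integers by the interval
  reversals, and label its \<open>j\<close>-th letter by the set of integers which that letter reverses, pulled
  back through the letters before it. The relations of the cactus group become, on labels, those of
  the right-angled Coxeter group on finite sets, where two sets commute iff they are disjoint or
  nested. In a right-angled Coxeter group two equal words have a common descendant under swaps of
  adjacent commuting letters and deletions of squares; no insertion is needed. Each swap or deletion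
  of labels lifts to a relation between words of intervals, and for words over a symmetric
  collection that relation only involves intervals of the collection. Since a word is determined by
  its labels, words over the collection which are equal in the cactus group are already equal in the
  group presented by the collection.
\<close>

section \<open>Presented groups\<close>

abbreviation pos_word :: "'a list \<Rightarrow> 'a word" where
  "pos_word \<equiv> map (\<lambda>x. (x, True))"

lemma pos_word_in_words_iff [simp]: "pos_word w \<in> words S \<longleftrightarrow> w \<in> lists S"
  by (induction w) auto

lemma map_fst_in_lists: "w \<in> words S \<Longrightarrow> map fst w \<in> lists S"
  by (auto simp: words_def lists_eq_set)

lemma words_mono: "I \<subseteq> S \<Longrightarrow> words I \<subseteq> words S"
  by (auto simp: words_def)

lemma pres_cong_Cons:
  "(u, v) \<in> pres_cong S R \<Longrightarrow> x \<in> S \<Longrightarrow> ((x, b) # u, (x, b) # v) \<in> pres_cong S R"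
  using pres_cong_context[of u v S R "[(x, b)]" "[]"] by simp

lemma pres_cong_rel_append:
  "(l, r) \<in> R \<Longrightarrow> l \<in> words S \<Longrightarrow> r \<in> words S \<Longrightarrow> w \<in> words S \<Longrightarrow> (l @ w, r @ w) \<in> pres_cong S R"
  using pres_cong.rel[of "[]" S w l r R] by simp

lemma pres_cong_letter_positive:
  assumes "(pos_word [x, x], []) \<in> R" and "x \<in> S" "w \<in> words S"
  shows "((x, b) # w, (x, True) # w) \<in> pres_cong S R"
proof (cases b)
  case True
  then show ?thesis
    using assms by (simp add: pres_cong.refl)
next
  case False
  have "(pos_word [x, x] @ w, [] @ w) \<in> pres_cong S R"
    using assms by (intro pres_cong_rel_append) simp_all
  then have "((x, False) # w, (x, False) # (x, True) # (x, True) # w) \<in> pres_cong S R"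
    using \<open>x \<in> S\<close> by (simp add: pres_cong_Cons[OF pres_cong.sym])
  moreover have "((x, False) # (x, True) # (x, True) # w, (x, True) # w) \<in> pres_cong S R"
    using pres_cong.cancel[of "[]" S "(x, True) # w" x False R] assms by simp
  ultimately have "((x, False) # w, (x, True) # w) \<in> pres_cong S R"
    by (rule pres_cong.trans)
  then show ?thesis
    using False by simp
qed

lemma pres_cong_pos_word:
  assumes "\<And>x. x \<in> S \<Longrightarrow> (pos_word [x, x], []) \<in> R" and "w \<in> words S"
  shows "(w, pos_word (map fst w)) \<in> pres_cong S R"
  using assms(2)
proof (induction w)
  case Nil
  then show ?case by (simp add: pres_cong.refl)
next
  case (Cons a w)
  obtain x b where a: "a = (x, b)"
    by (cases a)
  with Cons.prems have x: "x \<in> S" "w \<in> words S"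
    by simp_all
  then have "((x, b) # w, (x, True) # w) \<in> pres_cong S R"
    by (intro pres_cong_letter_positive assms(1))
  moreover have "((x, True) # w, (x, True) # pos_word (map fst w)) \<in> pres_cong S R"
    using x by (intro pres_cong_Cons Cons.IH)
  ultimately have "((x, b) # w, pos_word (map fst ((x, b) # w))) \<in> pres_cong S R"
    unfolding list.map fst_conv by (rule pres_cong.trans)
  then show ?case
    using a by simp
qed

lemma pres_cong_imp_equivclp:
  assumes "\<And>u v x b. x \<in> S \<Longrightarrow> P (f (u @ [(x, b), (x, \<not> b)] @ v)) (f (u @ v))"
    and "\<And>u v l r. (l, r) \<in> R \<Longrightarrow> P (f (u @ l @ v)) (f (u @ r @ v))"
    and "(u, v) \<in> pres_cong S R"
  shows "equivclp P (f u) (f v)"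
  using assms(3)
proof induction
  case (refl w)
  show ?case by (rule equivclp_refl)
next
  case (sym v w)
  show ?case using sym.IH by (rule equivclp_sym)
next
  case (trans u v w)
  show ?case using trans.IH by (rule equivclp_trans)
next
  case (cancel u v x b)
  then show ?case by (intro r_into_equivclp assms(1))
next
  case (rel u v l r)
  then show ?case by (intro r_into_equivclp assms(2))
qed

lemma pres_natural_hom:
  assumes "I \<subseteq> S"
  shows "pres_natural S R \<in> hom (presented_group I (rels_restrict R I)) (presented_group S R)"
  by (rule homI; elim presented_group_carrierE)
    (simp_all add: pres_natural_class[OF _ assms] words_mono[OF assms, THEN subsetD]
      presented_group_carrierI presented_group_mult)

lemma pres_natural_pres_gen:
  "x \<in> I \<Longrightarrow> I \<subseteq> S \<Longrightarrow> pres_natural S R (pres_gen I (rels_restrict R I) x) = pres_gen S R x"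
  by (simp add: pres_gen_def pres_natural_class)

lemma complete_gensI:
  assumes "I \<subseteq> S"
    and reflects: "\<And>u v. (u, v) \<in> pres_cong S R \<Longrightarrow> u \<in> words I \<Longrightarrow> v \<in> words I
      \<Longrightarrow> (u, v) \<in> pres_cong I (rels_restrict R I)"
  shows "complete_gens S R I"
  unfolding complete_gens_def
proof (intro conjI \<open>I \<subseteq> S\<close> inj_onI; elim presented_group_carrierE)
  fix A B u v
  assume eq: "pres_natural S R A = pres_natural S R B"
    and u: "u \<in> words I" "A = pres_cong I (rels_restrict R I) `` {u}"
    and v: "v \<in> words I" "B = pres_cong I (rels_restrict R I) `` {v}"
  then have "pres_cong S R `` {u} = pres_cong S R `` {v}"
    by (simp add: pres_natural_class \<open>I \<subseteq> S\<close>)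
  moreover have "v \<in> words S"
    using v(1) words_mono[OF \<open>I \<subseteq> S\<close>] by blast
  ultimately have "(u, v) \<in> pres_cong S R"
    by (rule eq_equiv_class[OF _ equiv_pres_cong])
  then show "A = B"
    using u v by (simp add: reflects pres_cong_class_eq)
qed

section \<open>Words in right-angled Coxeter groups\<close>

locale right_angled =
  fixes comm :: "'a \<Rightarrow> 'a \<Rightarrow> bool"
  assumes comm_sym: "comm a b \<Longrightarrow> comm b a"
begin

inductive trace_eq :: "'a list \<Rightarrow> 'a list \<Rightarrow> bool" where
  refl: "trace_eq w w"
| swap: "comm a b \<Longrightarrow> trace_eq (a # b # w) (b # a # w)"
| Cons: "trace_eq v w \<Longrightarrow> trace_eq (a # v) (a # w)"
| trans: "trace_eq u v \<Longrightarrow> trace_eq v w \<Longrightarrow> trace_eq u w"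

lemma trace_eq_sym: "trace_eq v w \<Longrightarrow> trace_eq w v"
proof (induction rule: trace_eq.induct)
  case (trans u v w)
  then show ?case by (blast intro: trace_eq.trans)
qed (simp_all add: trace_eq.refl trace_eq.Cons trace_eq.swap comm_sym)

inductive step :: "'a list \<Rightarrow> 'a list \<Rightarrow> bool" where
  swap: "comm a b \<Longrightarrow> step (a # b # w) (b # a # w)"
| delete: "step (a # a # w) w"
| Cons: "step v w \<Longrightarrow> step (a # v) (a # w)"

lemma steps_Cons: "step\<^sup>*\<^sup>* v w \<Longrightarrow> step\<^sup>*\<^sup>* (a # v) (a # w)"
  by (induction rule: rtranclp_induct) (simp, blast intro: rtranclp.rtrancl_into_rtrancl step.Cons)

lemma step_map:
  assumes "\<And>a b. comm a b \<Longrightarrow> comm (f a) (f b)" "step v w"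
  shows "step (map f v) (map f w)"
  using assms(2) by induction (auto intro: step.intros assms(1))

lemma trace_eq_imp_steps: "trace_eq v w \<Longrightarrow> step\<^sup>*\<^sup>* v w"
proof (induction rule: trace_eq.induct)
  case (trans u v w)
  then show ?case by (simp add: rtranclp_trans)
qed (simp_all add: r_into_rtranclp step.swap steps_Cons)

text \<open>\<open>pull a w\<close> removes from \<open>w\<close> an occurrence of \<open>a\<close> that can be moved to the front by swaps.\<close>

primrec pull :: "'a \<Rightarrow> 'a list \<Rightarrow> 'a list option" where
  "pull a [] = None"
| "pull a (b # w) = (if a = b then Some w else if comm a b then map_option ((#) b) (pull a w)
    else None)"

lemma trace_eq_Cons_pull: "pull a w = Some w' \<Longrightarrow> trace_eq w (a # w')"
proof (induction w arbitrary: w')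
  case (Cons b w)
  show ?case
  proof (cases "a = b")
    case False
    with Cons.prems obtain v where v: "comm a b" "pull a w = Some v" "w' = b # v"
      by (auto split: if_splits)
    then have "trace_eq (b # w) (b # a # v)"
      by (simp add: Cons.IH trace_eq.Cons)
    then show ?thesis
      using v by (blast intro: trace_eq.trans trace_eq.swap comm_sym)
  qed (use Cons.prems in \<open>auto intro: trace_eq.refl\<close>)
qed simp

lemma rel_option_pull: "trace_eq v w \<Longrightarrow> rel_option trace_eq (pull a v) (pull a w)"
proof (induction rule: trace_eq.induct)
  case (refl w)
  show ?case by (simp add: option.rel_refl trace_eq.refl)
next
  case (swap b c w)
  then show ?case
    by (cases "pull a w") (auto intro: trace_eq.intros dest: comm_sym)
next
  case (Cons v w b)
  then show ?case
    by (cases "pull a v"; cases "pull a w") (auto intro: trace_eq.Cons)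
next
  case (trans u v w)
  then show ?case
    by (cases "pull a u"; cases "pull a v"; cases "pull a w") (auto intro: trace_eq.trans)
qed

text \<open>The generators act on the reduced words up to swaps, as in van der Waerden's proof of the
  normal form theorem for free products.\<close>

definition act :: "'a \<Rightarrow> 'a list \<Rightarrow> 'a list" where
  "act a w = (case pull a w of None \<Rightarrow> a # w | Some w' \<Rightarrow> w')"

lemma trace_eq_act: "trace_eq v w \<Longrightarrow> trace_eq (act a v) (act a w)"
  using rel_option_pull[of v w a]
  by (auto simp: act_def intro: trace_eq.Cons split: option.splits)

primrec reduced :: "'a list \<Rightarrow> bool" where
  "reduced [] = True"
| "reduced (a # w) = (pull a w = None \<and> reduced w)"

lemma trace_eq_reduced_iff: "trace_eq v w \<Longrightarrow> reduced v = reduced w"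
proof (induction rule: trace_eq.induct)
  case (swap a b w)
  then show ?case
    using comm_sym by auto
next
  case (Cons v w a)
  then show ?case
    using rel_option_pull[of v w a] by (auto simp: option_rel_Some1)
qed simp_all

lemma reduced_Cons_pull: "reduced w \<Longrightarrow> pull a w = Some w' \<Longrightarrow> reduced (a # w')"
  using trace_eq_Cons_pull trace_eq_reduced_iff by blast

lemma reduced_act: "reduced w \<Longrightarrow> reduced (act a w)"
  using reduced_Cons_pull[of w a] by (auto simp: act_def split: option.split)

lemma trace_eq_act_act: "reduced w \<Longrightarrow> trace_eq (act a (act a w)) w"
  using reduced_Cons_pull[of w a] trace_eq_Cons_pull[of a w]
  by (auto simp: act_def intro: trace_eq.refl trace_eq_sym split: option.split)

lemma trace_eq_act_commute_pull:
  assumes "comm a b" "pull b w = Some v"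
  shows "trace_eq (act a (act b w)) (act b (act a w))"
proof (cases "a = b")
  case False
  have w: "trace_eq w (b # v)"
    using assms(2) by (rule trace_eq_Cons_pull)
  have "trace_eq (act b (act a w)) (act b (act a (b # v)))"
    by (intro trace_eq_act w)
  moreover have "act b (act a (b # v)) = act a v"
    using False assms(1) comm_sym by (cases "pull a v") (auto simp: act_def)
  moreover have "act b w = v"
    using assms(2) by (simp add: act_def)
  ultimately show ?thesis
    using trace_eq_sym by metis
qed (simp add: trace_eq.refl)

lemma trace_eq_act_commute:
  assumes "comm a b"
  shows "trace_eq (act a (act b w)) (act b (act a w))"
proof (cases "pull a w = None \<and> pull b w = None \<and> a \<noteq> b")
  case True
  then show ?thesis
    using assms comm_sym by (auto simp: act_def intro: trace_eq.swap)
next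
  case False
  then show ?thesis
    using trace_eq_act_commute_pull assms comm_sym trace_eq_sym trace_eq.refl
    by (metis option.exhaust)
qed

definition nf :: "'a list \<Rightarrow> 'a list" where
  "nf w = foldr act w []"

lemma reduced_nf: "reduced (nf w)"
  by (induction w) (auto simp: nf_def reduced_act)

lemma steps_act: "step\<^sup>*\<^sup>* (a # w) (act a w)"
proof (cases "pull a w")
  case (Some v)
  then have "step\<^sup>*\<^sup>* (a # w) (a # a # v)"
    by (intro steps_Cons trace_eq_imp_steps trace_eq_Cons_pull)
  then show ?thesis
    using Some step.delete by (auto simp: act_def intro: rtranclp.rtrancl_into_rtrancl)
qed (simp add: act_def)

lemma steps_nf: "step\<^sup>*\<^sup>* w (nf w)"
proof (induction w)
  case (Cons a w)
  then have "step\<^sup>*\<^sup>* (a # w) (a # nf w)"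
    by (rule steps_Cons)
  also have "step\<^sup>*\<^sup>* (a # nf w) (nf (a # w))"
    using steps_act by (simp add: nf_def)
  finally show ?case .
qed (simp add: nf_def)

lemma trace_eq_nf_step: "step v w \<Longrightarrow> trace_eq (nf v) (nf w)"
proof (induction rule: step.induct)
  case (delete a w)
  then show ?case
    using trace_eq_act_act[OF reduced_nf] by (simp add: nf_def)
qed (simp_all add: nf_def trace_eq_act_commute trace_eq_act)

lemma trace_eq_nf_steps: "step\<^sup>*\<^sup>* v w \<Longrightarrow> trace_eq (nf v) (nf w)"
  by (induction rule: rtranclp_induct) (blast intro: trace_eq.refl trace_eq.trans trace_eq_nf_step)+

theorem confluentp_step: "confluentp step"
proof (rule confluentpI)
  fix u v w
  assume "step\<^sup>*\<^sup>* u v" "step\<^sup>*\<^sup>* u w"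
  then have "trace_eq (nf v) (nf w)"
    by (blast intro: trace_eq_nf_steps trace_eq_sym trace_eq.trans)
  then have "step\<^sup>*\<^sup>* v (nf w)"
    using steps_nf[of v] trace_eq_imp_steps by (blast intro: rtranclp_trans)
  then show "\<exists>z. step\<^sup>*\<^sup>* v z \<and> step\<^sup>*\<^sup>* w z"
    using steps_nf by blast
qed

corollary church_rosser:
  assumes "equivclp step v w"
  obtains z where "step\<^sup>*\<^sup>* v z" "step\<^sup>*\<^sup>* w z"
  using assms semiconfluentp_equivclp[OF confluentp_imp_semiconfluentp[OF confluentp_step]]
  by (auto simp: rtranclp_conversep)

end

section \<open>Interval reversals\<close>

fun ivl :: "nat \<times> nat \<Rightarrow> nat set" where
  "ivl (p, q) = {p..q}"

fun flip :: "nat \<times> nat \<Rightarrow> nat \<Rightarrow> nat" where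
  "flip (p, q) i = (if i \<in> {p..q} then p + q - i else i)"

fun mirror :: "nat \<times> nat \<Rightarrow> nat \<times> nat \<Rightarrow> nat \<times> nat" where
  "mirror (p, q) (m, r) = (p + q - r, p + q - m)"

abbreviation proper :: "nat \<times> nat \<Rightarrow> bool" where
  "proper x \<equiv> fst x < snd x"

lemma flip_flip [simp]: "flip x (flip x i) = i"
  by (cases x) auto

lemma flip_comp_flip [simp]: "flip x \<circ> flip x = id"
  by (simp add: fun_eq_iff)

lemma inj_flip: "inj (flip x)"
  by (rule inj_on_inverseI[of _ "flip x"]) simp

lemma flip_in_ivl_iff [simp]: "flip x i \<in> ivl x \<longleftrightarrow> i \<in> ivl x"
  by (cases x) auto

lemma flip_outside: "i \<notin> ivl x \<Longrightarrow> flip x i = i"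
  by (cases x) auto

lemma ivl_eq_iff: "proper x \<Longrightarrow> proper y \<Longrightarrow> ivl x = ivl y \<longleftrightarrow> x = y"
  by (cases x; cases y) auto

lemma flip_image_ivl_superset:
  assumes "ivl x \<subseteq> ivl y"
  shows "flip x ` ivl y = ivl y"
proof
  show "flip x ` ivl y \<subseteq> ivl y"
  proof (rule image_subsetI)
    fix i assume "i \<in> ivl y"
    then show "flip x i \<in> ivl y"
      using assms flip_outside by (cases "i \<in> ivl x") (simp_all add: subsetD)
  qed
  then have "flip x ` flip x ` ivl y \<subseteq> flip x ` ivl y"
    by blast
  then show "ivl y \<subseteq> flip x ` ivl y"
    by (simp add: image_image)
qed

lemma flip_image_ivl_self: "flip x ` ivl x = ivl x"
  by (rule flip_image_ivl_superset) simp

lemma flip_image_ivl_disjoint: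
  assumes "ivl x \<inter> ivl y = {}"
  shows "flip x ` ivl y = ivl y"
proof -
  have "flip x i = i" if "i \<in> ivl y" for i
    using assms that by (intro flip_outside) blast
  then show ?thesis by simp
qed

lemma flip_image_ivl_subset:
  assumes "ivl y \<subseteq> ivl x" "proper y"
  shows "flip x ` ivl y = ivl (mirror x y)"
proof
  obtain p q m r where xy: "x = (p, q)" "y = (m, r)"
    by (cases x; cases y)
  then have bounds: "p \<le> m" "r \<le> q" "m < r"
    using assms by auto
  show "flip x ` ivl y \<subseteq> ivl (mirror x y)"
    using bounds xy by auto
  show "ivl (mirror x y) \<subseteq> flip x ` ivl y"
  proof
    fix i assume "i \<in> ivl (mirror x y)"
    then show "i \<in> flip x ` ivl y"
      using bounds xy by (intro image_eqI[of _ _ "p + q - i"]) auto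
  qed
qed

lemma flip_commute_disjoint:
  assumes "ivl x \<inter> ivl y = {}"
  shows "flip x \<circ> flip y = flip y \<circ> flip x"
proof
  fix i
  have "j \<notin> ivl y" if "j \<in> ivl x" for j
    using assms that by blast
  moreover have "j \<notin> ivl x" if "j \<in> ivl y" for j
    using assms that by blast
  ultimately show "(flip x \<circ> flip y) i = (flip y \<circ> flip x) i"
    by (cases "i \<in> ivl x"; cases "i \<in> ivl y") (simp_all add: flip_outside)
qed

lemma flip_commute_subset:
  assumes "ivl y \<subseteq> ivl x" "proper y"
  shows "flip x \<circ> flip y = flip (mirror x y) \<circ> flip x"
proof -
  obtain p q m r where xy: "x = (p, q)" "y = (m, r)"
    by (cases x; cases y)
  then have "p \<le> m" "r \<le> q" "m < r"
    using assms by auto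
  then have "flip x (flip y i) = flip (mirror x y) (flip x i)" for i
    unfolding xy by (cases "i \<in> {m..r}"; cases "i \<in> {p..q}") auto
  then show ?thesis by auto
qed

lemma mirror_subset: "ivl y \<subseteq> ivl x \<Longrightarrow> proper y \<Longrightarrow> ivl (mirror x y) \<subseteq> ivl x"
  by (cases x; cases y) auto

lemma mirror_mirror: "ivl y \<subseteq> ivl x \<Longrightarrow> proper y \<Longrightarrow> mirror x (mirror x y) = y"
  by (cases x; cases y) auto

text \<open>\<open>conjugates x y z\<close> stands for the relation \<open>s\<^sub>x s\<^sub>y = s\<^sub>z s\<^sub>x\<close>, of type (j2) or (j3).\<close>

inductive conjugates :: "nat \<times> nat \<Rightarrow> nat \<times> nat \<Rightarrow> nat \<times> nat \<Rightarrow> bool" where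
  disjoint: "ivl x \<inter> ivl y = {} \<Longrightarrow> conjugates x y y"
| inside: "ivl y \<subseteq> ivl x \<Longrightarrow> conjugates x y (mirror x y)"

lemma conjugates_flip:
  assumes "conjugates x y z" "proper y"
  shows "flip z \<circ> flip x = flip x \<circ> flip y"
  using assms by cases (auto simp: flip_commute_subset dest: flip_commute_disjoint)

lemma conjugates_flip_image:
  assumes "conjugates x y z" "proper y"
  shows "flip x ` ivl y = ivl z" and "flip z ` ivl x = ivl x"
  using assms
  by (cases; simp add: flip_image_ivl_disjoint flip_image_ivl_subset flip_image_ivl_superset
      mirror_subset Int_commute)+

lemma cactus_gens_proper: "x \<in> cactus_gens n \<Longrightarrow> proper x"
  by (auto simp: cactus_gens_def)

lemma cactus_rels_eq:
  "cactus_rels n = {(pos_word [x, x], []) | x. x \<in> cactus_gens n} \<union>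
    {(pos_word [x, y], pos_word [z, x]) | x y z.
      x \<in> cactus_gens n \<and> y \<in> cactus_gens n \<and> conjugates x y z}"
proof -
  have "cactus_rels n = {(pos_word [x, x], []) | x. x \<in> cactus_gens n} \<union>
      {(pos_word [x, y], pos_word [y, x]) | x y.
        x \<in> cactus_gens n \<and> y \<in> cactus_gens n \<and> ivl x \<inter> ivl y = {}} \<union>
      {(pos_word [x, y], pos_word [mirror x y, x]) | x y.
        x \<in> cactus_gens n \<and> y \<in> cactus_gens n \<and> ivl y \<subseteq> ivl x}"
    by (simp add: cactus_rels_def)
  then show ?thesis
    by (auto simp: conjugates.simps)
qed

section \<open>Labels\<close>

definition compatible :: "'a set \<Rightarrow> 'a set \<Rightarrow> bool" where
  "compatible A B \<longleftrightarrow> A \<inter> B = {} \<or> A \<subseteq> B \<or> B \<subseteq> A"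

lemma compatible_image_iff: "inj f \<Longrightarrow> compatible (f ` A) (f ` B) \<longleftrightarrow> compatible A B"
  unfolding compatible_def by (simp add: inj_image_subset_iff image_Int[symmetric])

lemma conjugates_compatible:
  assumes "conjugates x y z" "proper y"
  shows "compatible (ivl x) (ivl z)"
  using assms by cases (simp_all add: compatible_def mirror_subset)

interpretation label: right_angled compatible
  by unfold_locales (auto simp: compatible_def)

primrec labels :: "(nat \<times> nat) list \<Rightarrow> nat set list" where
  "labels [] = []"
| "labels (x # w) = ivl x # map ((`) (flip x)) (labels w)"

lemma map_flip_image_map_flip_image: "map ((`) (flip x)) (map ((`) (flip x)) L) = L"
  by (simp add: comp_def image_image)

lemma labels_Cons_Cons:
  "labels (x # y # w) = ivl x # flip x ` ivl y # map ((`) (flip x \<circ> flip y)) (labels w)"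
  by (simp add: image_comp)

lemma labels_eq_Cons_ConsE:
  assumes "labels w = A # B # L"
  obtains x y u where "w = x # y # u" "A = ivl x" "B = flip x ` ivl y"
proof (cases w)
  case (Cons x v)
  with assms have "v \<noteq> []"
    by auto
  then obtain y u where "v = y # u"
    by (auto simp: neq_Nil_conv)
  then show ?thesis
    using that[of x y u] assms Cons by simp
qed (use assms in simp)

lemma labels_inject:
  assumes "labels u = labels v" "u \<in> lists {x. proper x}" "v \<in> lists {x. proper x}"
  shows "u = v"
  using assms
proof (induction u arbitrary: v)
  case Nil
  then show ?case by (cases v) auto
next
  case (Cons x u)
  then obtain y v' where v: "v = y # v'"
    by (cases v) auto
  with Cons.prems have "x = y"
    by (simp add: ivl_eq_iff)
  moreover have "inj ((`) (flip x))"
    by (simp add: inj_def inj_image_eq_iff[OF inj_flip])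
  ultimately have "labels u = labels v'"
    using Cons.prems(1) v by simp
  then show ?case
    using Cons \<open>x = y\<close> v by simp
qed

lemma labels_square: "labels (x # x # w) = ivl x # ivl x # labels w"
  unfolding labels_Cons_Cons by (simp add: flip_image_ivl_self)

lemma labels_conjugates:
  assumes "conjugates x y z" "proper y"
  shows "labels (x # y # w) = ivl x # ivl z # map ((`) (flip x \<circ> flip y)) (labels w)"
    and "labels (z # x # w) = ivl z # ivl x # map ((`) (flip x \<circ> flip y)) (labels w)"
  by (simp_all only: labels_Cons_Cons conjugates_flip[OF assms] conjugates_flip_image[OF assms])

lemma step_map_flip_image:
  "label.step v w \<Longrightarrow> label.step (map ((`) (flip x)) v) (map ((`) (flip x)) w)"
  by (rule label.step_map) (simp add: compatible_image_iff inj_flip)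

lemma labels_step_append:
  "label.step (labels v) (labels w) \<Longrightarrow> label.step (labels (u @ v)) (labels (u @ w))"
  by (induction u) (auto intro: label.step.Cons step_map_flip_image)

lemma labels_step_cactus_rels:
  assumes "(l, r) \<in> cactus_rels n"
  shows "label.step (labels (map fst (l @ w))) (labels (map fst (r @ w)))"
proof -
  from assms consider
      (square) x where "l = pos_word [x, x]" "r = []"
    | (conjugates) x y z where "l = pos_word [x, y]" "r = pos_word [z, x]"
      "conjugates x y z" "proper y"
    unfolding cactus_rels_eq by (auto dest: cactus_gens_proper)
  then show ?thesis
  proof cases
    case square
    then have "map fst (l @ w) = x # x # map fst w" "map fst (r @ w) = map fst w"
      by simp_all
    then show ?thesis
      by (simp only: labels_square label.step.delete)
  next
    case conjugates
    then have words: "map fst (l @ w) = x # y # map fst w" "map fst (r @ w) = z # x # map fst w"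
      by simp_all
    show ?thesis
      unfolding words labels_conjugates[OF conjugates(3,4)]
      by (rule label.step.swap[OF conjugates_compatible[OF conjugates(3,4)]])
  qed
qed

lemma equivclp_step_labels:
  assumes "(u, v) \<in> pres_cong (cactus_gens n) (cactus_rels n)"
  shows "equivclp label.step (labels (map fst u)) (labels (map fst v))"
proof (rule pres_cong_imp_equivclp[OF _ _ assms])
  fix u v :: "(nat \<times> nat) word" and x b
  have "label.step (labels (x # x # map fst v)) (labels (map fst v))"
    unfolding labels_square by (rule label.step.delete)
  then show "label.step (labels (map fst (u @ [(x, b), (x, \<not> b)] @ v))) (labels (map fst (u @ v)))"
    using labels_step_append by simp
next
  fix u v l r
  assume "(l, r) \<in> cactus_rels n"
  then show "label.step (labels (map fst (u @ l @ v))) (labels (map fst (u @ r @ v)))"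
    unfolding map_append[of fst u] by (intro labels_step_append labels_step_cactus_rels)
qed

section \<open>Lifting to a symmetric collection\<close>

locale symmetric_intervals =
  fixes n :: nat and C :: "(nat \<times> nat) set"
  assumes C_gens: "C \<subseteq> cactus_gens n"
    and C_symmetric: "symmetric_collection C"
begin

abbreviation cong :: "((nat \<times> nat) word \<times> (nat \<times> nat) word) set" where
  "cong \<equiv> pres_cong C (rels_restrict (cactus_rels n) C)"

lemma C_proper: "x \<in> C \<Longrightarrow> proper x"
  using C_gens cactus_gens_proper by blast

lemma mirror_in_C: "x \<in> C \<Longrightarrow> y \<in> C \<Longrightarrow> ivl y \<subseteq> ivl x \<Longrightarrow> mirror x y \<in> C"
  using C_symmetric unfolding symmetric_collection_def by (cases x; cases y) auto

lemma square_in_rels_restrict: "x \<in> C \<Longrightarrow> (pos_word [x, x], []) \<in> rels_restrict (cactus_rels n) C"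
  using C_gens unfolding rels_restrict_def cactus_rels_eq by fastforce

lemma cong_conjugates:
  assumes "{x, y, z} \<subseteq> C" "conjugates x y z" "w \<in> lists C"
  shows "(pos_word (x # y # w), pos_word (z # x # w)) \<in> cong"
proof -
  have "(pos_word [x, y], pos_word [z, x]) \<in> rels_restrict (cactus_rels n) C"
    using assms C_gens unfolding rels_restrict_def cactus_rels_eq by fastforce
  from pres_cong_rel_append[OF this, of C "pos_word w"] show ?thesis
    using assms by simp
qed

lemma compatible_conjugates_cases:
  assumes "x \<in> C" "y \<in> C" "compatible (ivl x) (ivl y)"
  obtains (left) z where "z \<in> C" "conjugates x y z" | (right) z where "z \<in> C" "conjugates y z x"
proof -
  from assms(3) consider (disjoint) "ivl x \<inter> ivl y = {}" | (inside) "ivl y \<subseteq> ivl x"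
    | (outside) "ivl x \<subseteq> ivl y"
    by (auto simp: compatible_def)
  then show ?thesis
  proof cases
    case disjoint
    then show ?thesis
      using left assms(2) conjugates.disjoint by blast
  next
    case inside
    then show ?thesis
      using left assms conjugates.inside mirror_in_C by blast
  next
    case outside
    then have "conjugates y (mirror y x) (mirror y (mirror y x))"
      using assms by (intro conjugates.inside mirror_subset C_proper)
    then have "conjugates y (mirror y x) x"
      using outside assms by (simp add: mirror_mirror C_proper)
    then show ?thesis
      using right outside assms mirror_in_C by blast
  qed
qed

lemma lift_swap:
  assumes "labels w = A # B # L" "compatible A B" "w \<in> lists C"
  shows "\<exists>w'\<in>lists C. labels w' = B # A # L \<and> (pos_word w, pos_word w') \<in> cong"
proof -
  from assms(1) obtain x y u where w: "w = x # y # u" and AB: "A = ivl x" "B = flip x ` ivl y"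
    by (rule labels_eq_Cons_ConsE)
  then have in_C: "x \<in> C" "y \<in> C" "u \<in> lists C"
    using assms(3) by auto
  have "compatible (flip x ` ivl x) (flip x ` ivl y)"
    using assms(2) unfolding AB flip_image_ivl_self .
  then have "compatible (ivl x) (ivl y)"
    by (simp only: compatible_image_iff[OF inj_flip])
  with in_C(1,2) show ?thesis
  proof (cases rule: compatible_conjugates_cases)
    case (left z)
    have "labels (z # x # u) = B # A # L"
      using assms(1) unfolding w labels_conjugates[OF left(2) C_proper[OF in_C(2)]] by simp
    moreover have "(pos_word w, pos_word (z # x # u)) \<in> cong"
      unfolding w using left in_C by (intro cong_conjugates) simp_all
    ultimately show ?thesis
      using left in_C by (intro bexI[of _ "z # x # u"]) simp_all
  next
    case (right z)
    have "labels (y # z # u) = B # A # L"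
      using assms(1) unfolding w labels_conjugates[OF right(2) C_proper[OF right(1)]] by simp
    moreover have "(pos_word w, pos_word (y # z # u)) \<in> cong"
      unfolding w using right in_C by (intro pres_cong.sym[OF cong_conjugates]) simp_all
    ultimately show ?thesis
      using right in_C by (intro bexI[of _ "y # z # u"]) simp_all
  qed
qed

lemma lift_delete:
  assumes "labels w = A # A # L" "w \<in> lists C"
  shows "\<exists>w'\<in>lists C. labels w' = L \<and> (pos_word w, pos_word w') \<in> cong"
proof -
  from assms(1) obtain x y u where w: "w = x # y # u" and A: "A = ivl x" "A = flip x ` ivl y"
    by (rule labels_eq_Cons_ConsE)
  then have "flip x ` ivl x = flip x ` ivl y"
    by (simp only: flip_image_ivl_self)
  then have "ivl x = ivl y"
    by (simp only: inj_image_eq_iff inj_flip)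
  then have "x = y"
    using assms(2) w by (simp add: C_proper ivl_eq_iff)
  then have "labels u = L"
    using assms(1) w labels_square[of x u] by simp
  moreover have "(pos_word [x, x] @ pos_word u, [] @ pos_word u) \<in> cong"
    using assms(2) w by (intro pres_cong_rel_append square_in_rels_restrict) simp_all
  ultimately show ?thesis
    using assms(2) w \<open>x = y\<close> by (intro bexI[of _ u]) simp_all
qed

lemma lift_step:
  assumes "label.step (labels w) L" "w \<in> lists C"
  shows "\<exists>w'\<in>lists C. labels w' = L \<and> (pos_word w, pos_word w') \<in> cong"
  using assms
proof (induction w arbitrary: L)
  case Nil
  then show ?case by (auto elim: label.step.cases)
next
  case (Cons x u)
  from Cons.prems(1) show ?case
  proof cases
    case (swap A B M)
    then show ?thesis
      using Cons.prems(2) by (simp only: lift_swap)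
  next
    case (delete A)
    then show ?thesis
      using Cons.prems(2) by (intro lift_delete)
  next
    case (Cons M M' A)
    then have M: "M = map ((`) (flip x)) (labels u)" and L: "L = ivl x # M'"
      by simp_all
    have "label.step (labels u) (map ((`) (flip x)) M')"
      using step_map_flip_image[OF Cons(3), of x] unfolding M map_flip_image_map_flip_image .
    moreover have "u \<in> lists C"
      using Cons.prems(2) by simp
    ultimately obtain u' where u': "u' \<in> lists C" "labels u' = map ((`) (flip x)) M'"
      "(pos_word u, pos_word u') \<in> cong"
      using Cons.IH by blast
    then have "labels (x # u') = L"
      using L by (simp only: labels.simps map_flip_image_map_flip_image)
    then show ?thesis
      using u' Cons.prems(2) by (intro bexI[of _ "x # u'"]) (auto intro: pres_cong_Cons)
  qed
qed

lemma lift_steps: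
  assumes "label.step\<^sup>*\<^sup>* (labels w) L" "w \<in> lists C"
  shows "\<exists>w'\<in>lists C. labels w' = L \<and> (pos_word w, pos_word w') \<in> cong"
  using assms(1)
proof (induction rule: rtranclp_induct)
  case base
  then show ?case
    using assms(2) by (intro bexI[of _ w]) (simp_all add: pres_cong.refl)
next
  case (step L M)
  then obtain v where v: "v \<in> lists C" "labels v = L" "(pos_word w, pos_word v) \<in> cong"
    by blast
  with step.hyps(2) obtain w' where "w' \<in> lists C" "labels w' = M"
    "(pos_word v, pos_word w') \<in> cong"
    using lift_step by blast
  then show ?case
    using pres_cong.trans[OF v(3)] by blast
qed

theorem cactus_cong_imp_cong:
  assumes "(u, v) \<in> pres_cong (cactus_gens n) (cactus_rels n)" "u \<in> words C" "v \<in> words C"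
  shows "(u, v) \<in> cong"
proof -
  from assms(1) obtain L where
    "label.step\<^sup>*\<^sup>* (labels (map fst u)) L" "label.step\<^sup>*\<^sup>* (labels (map fst v)) L"
    using equivclp_step_labels label.church_rosser by metis
  then obtain u' v' where "u' \<in> lists C" "v' \<in> lists C" and "labels u' = L" "labels v' = L"
    and u': "(pos_word (map fst u), pos_word u') \<in> cong"
    and v': "(pos_word (map fst v), pos_word v') \<in> cong"
    using lift_steps assms(2,3) map_fst_in_lists by metis
  then have "u' = v'"
    by (intro labels_inject) (auto dest: C_proper)
  moreover have "(u, pos_word (map fst u)) \<in> cong" "(v, pos_word (map fst v)) \<in> cong"
    using pres_cong_pos_word[OF square_in_rels_restrict] assms(2,3) by blast+
  ultimately show ?thesis
    using u' v' by (meson pres_cong.sym pres_cong.trans)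
qed

end

theorem theorem3p7:
  fixes n :: nat and C :: "(nat \<times> nat) set"
  assumes "n \<ge> 2"
    and "C \<subseteq> cactus_gens n"
    and "symmetric_collection C"
  shows "pres_natural (cactus_gens n) (cactus_rels n)
      \<in> hom (cactus_restricted_group n C) (cactus_group n)
    \<and> (\<forall>I\<in>C. pres_natural (cactus_gens n) (cactus_rels n)
          (pres_gen C (rels_restrict (cactus_rels n) C) I)
        = pres_gen (cactus_gens n) (cactus_rels n) I)
    \<and> inj_on (pres_natural (cactus_gens n) (cactus_rels n)) (carrier (cactus_restricted_group n C))
    \<and> complete_gens (cactus_gens n) (cactus_rels n) C"
proof -
  interpret symmetric_intervals n C
    using assms by unfold_locales
  have complete: "complete_gens (cactus_gens n) (cactus_rels n) C"
    using C_gens by (rule complete_gensI) (rule cactus_cong_imp_cong)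
  then have "inj_on (pres_natural (cactus_gens n) (cactus_rels n))
      (carrier (cactus_restricted_group n C))"
    by (simp add: complete_gens_def cactus_restricted_group_def)
  with complete show ?thesis
    using pres_natural_hom[OF C_gens] pres_natural_pres_gen[OF _ C_gens]
    by (simp add: cactus_restricted_group_def cactus_group_def)
qed

end
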